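(* Let $E \in \mathbb{R}^{n \times n}$ be an $\mathcal{H}_r(\mathcal{P})$-matrix with a dendrogram $\mathcal{P}$ of height $h$ and maximum degree $d$. Then there are matrices $C \in \mathbb{R}^{n \times p}$ and $D \in \mathbb{R}^{p \times n}$ such that $p \leq rd^2n$ and the factorization $E = CD$ is $k$-sparse for $k = rd(d-1)(h+1)$.
   Context: Dendrogram: a dendrogram $\mathcal{P}$ is a hierarchical partitioning of $\{1,\dots,n\}$, i.e. a sequence of increasingly finer partitions $P_h,\dots,P_0$, where $P_h$ is the one-block partition (the whole set) and $P_0$ is the partition into $n$ singletons. It is represented as a rooted directed tree whose nodes at height $i$ are the sets of $P_i$; the children of a node at height $i$ are the subsets of this node belonging to $P_{i-1}$. The number $h$ is the height, and the maximum number of children of a node is the maximum degree $d$. Without loss of generality, every node of a dendrogram is assumed to consist of consecutive integers. $\mathcal{P}$-partitioning: an $n\times n$ matrix $E$ is block-partitioned, in rows and columns, according to $P_{h-1}=\{I_1,\dots,I_t\}$ into blocks $E_{I_i\times I_j}$; the diagonal blocks $E_{I_i\times I_i}$ are recursively sub-partitioned according to $P_{h-2}$, etc. An elementary block is a sub-matrix of $E$ generated by this procedure that is not further subdivided, i.e. a generated block $E_{I\times J}$ where $I,J$ are either two different sets of the same partition $P_k$, or single-element sets of the finest partition $P_0$. $E$ is an $\mathcal{H}_r(\mathcal{P})$-matrix ($r\in\mathbb{N}$) if all its elementary blocks have rank at most $r$. $k$-sparse factorization: let $E=CD$, with $C$ having columns $c_1,\dots,c_p$ and $D$ having columns $d_1,\dots,d_n$.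 The support $\mathrm{supp}(v)$ of a vector $v$ is the set of indices of its nonzero entries. The forward-overlap $FO(c_i)$ is the list of columns $c_j$, $j\ge i$, whose support overlaps (intersects) the support of $c_i$. The factorization is $k$-sparse if $\left|\bigcup_{i\in \mathrm{supp}(d_j)} FO(c_i)\right|\le k$ for all $j$. By convention (without loss of generality) each column of $C$ and each row of $D$ is supposed to be nonzero.
   Formalization: The formal theorem assumes n ≥ 2, because for n = 1 the claim fails: with E = [1] and r = 1, either d = 0 forces p = 0 and hence E = 0, or d = 1 gives k = 0, which no factorization of a nonzero matrix satisfies. *)

theory Defs
  imports
    "HOL-Library.Disjoint_Sets"
    "Jordan_Normal_Form.DL_Rank"
    "Jordan_Normal_Form.DL_Submatrix"
begin

(* Matrix indices start at 0, so {..<n} plays the role of {1,...,n}. *)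

section \<open>Dendrograms\<close>

(* P i is the partition at height i; values P i with i > h are irrelevant.
   Consecutive partitions are not required to be distinct. *)
definition dendrogram :: "nat \<Rightarrow> nat \<Rightarrow> (nat \<Rightarrow> nat set set) \<Rightarrow> bool" where
  "dendrogram n h P \<longleftrightarrow>
     (\<forall>i\<le>h. partition_on {..<n} (P i)) \<and>
     P h = {{..<n}} \<and>
     P 0 = (\<lambda>j. {j}) ` {..<n} \<and>
     (\<forall>i<h. refines {..<n} (P i) (P (Suc i))) \<and>
     (\<forall>i\<le>h. \<forall>I\<in>P i. \<exists>a b. I = {a..<b})"

(* Nodes of the tree are pairs of a height i and a set in P i: the same set occurring
   at two heights gives two nodes. Nodes at height 0 are leaves. *)
definition children :: "(nat \<Rightarrow> nat set set) \<Rightarrow> nat \<Rightarrow> nat set \<Rightarrow> nat set set" where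
  "children P i N = {I. 0 < i \<and> I \<in> P (i - 1) \<and> I \<subseteq> N}"

definition max_degree :: "nat \<Rightarrow> (nat \<Rightarrow> nat set set) \<Rightarrow> nat" where
  "max_degree h P = Max {card (children P i N) | i N. i \<le> h \<and> N \<in> P i}"

section \<open>Hierarchical matrices\<close>

(* generated_block P h i I J: the recursive block partitioning reaches the block with
   rows I and columns J, where I and J belong to P i. Only diagonal blocks are
   partitioned further. *)
inductive generated_block ::
  "(nat \<Rightarrow> nat set set) \<Rightarrow> nat \<Rightarrow> nat \<Rightarrow> nat set \<Rightarrow> nat set \<Rightarrow> bool"
  for P :: "nat \<Rightarrow> nat set set" and h :: nat where
  whole: "I \<in> P h \<Longrightarrow> generated_block P h h I I"
| split: "generated_block P h (Suc i) N N \<Longrightarrow>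
    I \<in> children P (Suc i) N \<Longrightarrow> J \<in> children P (Suc i) N \<Longrightarrow>
    generated_block P h i I J"

definition elementary_block ::
  "(nat \<Rightarrow> nat set set) \<Rightarrow> nat \<Rightarrow> nat set \<Rightarrow> nat set \<Rightarrow> bool" where
  "elementary_block P h I J \<longleftrightarrow>
     (\<exists>i. generated_block P h i I J \<and> (I \<noteq> J \<or> i = 0))"

definition H_matrix ::
  "nat \<Rightarrow> (nat \<Rightarrow> nat set set) \<Rightarrow> nat \<Rightarrow> nat \<Rightarrow> real mat \<Rightarrow> bool" where
  "H_matrix n P h r E \<longleftrightarrow>
     E \<in> carrier_mat n n \<and>
     (\<forall>I J. elementary_block P h I J \<longrightarrow>
        vec_space.rank (card I) (submatrix E I J) \<le> r)"

section \<open>Sparse factorizations\<close>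

definition supp :: "real vec \<Rightarrow> nat set" where
  "supp v = {i. i < dim_vec v \<and> v $ i \<noteq> 0}"

(* The list of columns is represented by the set of their indices, so that equal columns
   at different positions are counted separately. *)
definition forward_overlap :: "real mat \<Rightarrow> nat \<Rightarrow> nat set" where
  "forward_overlap C i =
     {j. i \<le> j \<and> j < dim_col C \<and> supp (col C i) \<inter> supp (col C j) \<noteq> {}}"

definition k_sparse_factorization ::
  "nat \<Rightarrow> real mat \<Rightarrow> real mat \<Rightarrow> real mat \<Rightarrow> bool" where
  "k_sparse_factorization k E C D \<longleftrightarrow>
     dim_col C = dim_row D \<and> E = C * D \<and>
     (\<forall>i<dim_col C. col C i \<noteq> 0\<^sub>v (dim_row C)) \<and>
     (\<forall>i<dim_row D. row D i \<noteq> 0\<^sub>v (dim_col D)) \<and>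
     (\<forall>j<dim_col D. card (\<Union>i\<in>supp (col D j). forward_overlap C i) \<le> k)"

end

theory Submission
  imports Defs
begin

text \<open>Write every elementary block of \<open>E\<close> as a sum of \<open>r\<close> rank-one terms and let \<open>C\<close> and \<open>D\<close>
  collect the column and row factors, ordered by increasing height of the block. If a term
  with a nonzero entry in column \<open>j\<close> comes from height \<open>i\<close>, then every term of at least that
  height whose rows overlap comes from a block at some height \<open>i' \<ge> i\<close> inside the node of
  \<open>P (i' + 1)\<close> containing \<open>j\<close>; each such node has at most \<open>d (d - 1)\<close> off-diagonal
  blocks, and at height 0 at most \<open>d \<le> d (d - 1)\<close> diagonal ones. A node with \<open>c\<close> children has
  \<open>c (c - 1) \<le> d (c - 1)\<close> off-diagonal blocks, and the sum of \<open>c - 1\<close> over all nodes telescopes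
  to \<open>n - 1\<close>, so there are at most \<open>d n + n \<le> d\<^sup>2 n\<close> blocks.\<close>

section \<open>Sums of rank-one terms\<close>

text \<open>A maximal independent set \<open>S\<close> of columns has at most \<open>r\<close>
  elements and, by maximality, spans every column. The vectors of \<open>S\<close> serve as the left
  factors, and the coefficients of the columns over \<open>S\<close> as the right factors.\<close>

lemma (in vec_space) rank_le_imp_sum_rank_one:
  assumes A: "A \<in> carrier_mat n nc" and r: "rank A \<le> r"
  shows "\<exists>u v. \<forall>i<n. \<forall>j<nc. A $$ (i, j) = (\<Sum>s<r. u s i * v s j)"
proof -
  have cols: "set (cols A) \<subseteq> carrier_vec n"
    using cols_dim A by blast
  obtain S where S: "finite S" "maximal S (\<lambda>T. T \<subseteq> set (cols A) \<and> lin_indpt T)"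
    using maximal_exists_superset[of "set (cols A)" "\<lambda>T. T \<subseteq> set (cols A) \<and> lin_indpt T" "{}"]
    by (metis (no_types, lifting) List.finite_set empty_subsetI finite.emptyI
        finite_lin_indpt2 empty_iff)
  then have S': "S \<subseteq> set (cols A)" "lin_indpt S" "S \<subseteq> carrier_vec n"
    using cols unfolding maximal_def by auto
  have card: "card S \<le> r"
    using rank_card_indpt[OF A S(2)] r by simp
  have "\<exists>a. lincomb a S = col A j" if j: "j < nc" for j
  proof -
    have c: "col A j \<in> set (cols A)"
      using j A by (auto simp: cols_def)
    have "col A j \<in> span S"
    proof (cases "col A j \<in> S")
      case True
      then show ?thesis
        using span_mem[OF S'(3)] by blast
    next
      case False
      then have "\<not> (S \<union> {col A j} \<subseteq> set (cols A) \<and> lin_indpt (S \<union> {col A j}))"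
        using S(2) unfolding maximal_def by (metis Un_upper1 Un_iff insertI1)
      then show ?thesis
        using lin_dep_iff_in_span[OF S'(3,2) _ False] c cols S'(1) by blast
    qed
    then show ?thesis
      using finite_in_span[OF S(1) S'(3)] by blast
  qed
  then obtain a where a: "\<And>j. j < nc \<Longrightarrow> lincomb (a j) S = col A j"
    by metis
  obtain e where e: "bij_betw e {..<card S} S"
    using ex_bij_betw_nat_finite[OF S(1)] by (auto simp: atLeast0LessThan)
  \<comment> \<open>The set \<open>S\<close> may have fewer than \<open>r\<close> elements; the
    default value 0 pads the sum to exactly \<open>r\<close> terms.\<close>
  define u where "u s i = (if s < card S then e s $ i else 0)" for s i
  have "A $$ (i, j) = (\<Sum>s<r. u s i * a j (e s))" if i: "i < n" and j: "j < nc" for i j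
  proof -
    have "A $$ (i, j) = lincomb (a j) S $ i"
      using a[OF j] i j A by simp
    also have "\<dots> = (\<Sum>x\<in>S. a j x * x $ i)"
      by (rule lincomb_index[OF i S'(3)])
    also have "\<dots> = (\<Sum>s<card S. a j (e s) * e s $ i)"
      by (rule sum.reindex_bij_betw[OF e, symmetric])
    also have "\<dots> = (\<Sum>s<card S. u s i * a j (e s))"
      by (simp add: u_def mult.commute)
    also have "\<dots> = (\<Sum>s<r. u s i * a j (e s))"
      using card by (intro sum.mono_neutral_left) (auto simp: u_def)
    finally show ?thesis .
  qed
  then show ?thesis
    by (intro exI[of _ u] exI[of _ "\<lambda>s j. a j (e s)"]) simp
qed

text \<open>The decomposition of the block is carried back to the index range of \<open>E\<close>
  and extended by zero. The vanishing outside \<open>I\<close> and \<open>J\<close> allows the terms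
  of different blocks to be added without interference.\<close>

lemma submatrix_rank_le_imp_sum_rank_one:
  fixes E :: "real mat"
  assumes E: "E \<in> carrier_mat n n" and IJ: "I \<subseteq> {..<n}" "J \<subseteq> {..<n}"
    and rank: "vec_space.rank (card I) (submatrix E I J) \<le> r"
  shows "\<exists>u v. (\<forall>i\<in>I. \<forall>j\<in>J. E $$ (i, j) = (\<Sum>s<r. u s i * v s j)) \<and>
           (\<forall>s. \<forall>i. i \<notin> I \<longrightarrow> u s i = 0) \<and> (\<forall>s. \<forall>j. j \<notin> J \<longrightarrow> v s j = 0)"
proof -
  have eq: "{i. i < n \<and> i \<in> I} = I" "{j. j < n \<and> j \<in> J} = J"
    using IJ by auto
  have fin: "finite I" "finite J"
    using IJ finite_subset by auto
  have "submatrix E I J \<in> carrier_mat (card I) (card J)"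
    using E eq by (intro carrier_matI) (simp_all add: dim_submatrix)
  from vec_space.rank_le_imp_sum_rank_one[OF this rank] obtain u v where
    uv: "\<And>i j. i < card I \<Longrightarrow> j < card J \<Longrightarrow>
        submatrix E I J $$ (i, j) = (\<Sum>s<r. u s i * v s j)"
    by blast
  \<comment> \<open>The position of \<open>i\<close> in the increasing enumeration of
    \<open>I\<close>, hence its row or column number in the submatrix.\<close>
  define p where "p I i = card {a \<in> I. a < i}" for I :: "nat set" and i
  have p: "p I i < card I" if "i \<in> I" "finite I" for I i
    unfolding p_def using that by (intro psubset_card_mono) auto
  have "E $$ (i, j) = (\<Sum>s<r. u s (p I i) * v s (p J j))" if "i \<in> I" "j \<in> J" for i j
  proof -
    have "i < dim_row E" "j < dim_col E"
      using that IJ E by auto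
    then show ?thesis
      using uv[OF p p, OF that(1) fin(1) that(2) fin(2)] submatrix_index_card[of i E j I J] that
      unfolding p_def by simp
  qed
  then show ?thesis
    by (intro exI[of _ "\<lambda>s i. if i \<in> I then u s (p I i) else 0"]
        exI[of _ "\<lambda>s j. if j \<in> J then v s (p J j) else 0"]) auto
qed

text \<open>The columns of \<open>C\<close> are listed by increasing \<open>ht\<close>, so that a forward overlap only
  contains columns of at least the same \<open>ht\<close>.\<close>

lemma k_sparse_factorization_of_rank_one_terms:
  fixes u v :: "'a \<Rightarrow> nat \<Rightarrow> real" and ht :: "'a \<Rightarrow> nat"
  assumes T: "finite T" and E: "E \<in> carrier_mat n m"
    and entry: "\<And>i j. i < n \<Longrightarrow> j < m \<Longrightarrow> E $$ (i, j) = (\<Sum>t\<in>T. u t i * v t j)"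
    and bound: "\<And>j. j < m \<Longrightarrow> card {t' \<in> T. \<exists>t\<in>T. v t j \<noteq> 0 \<and> ht t \<le> ht t' \<and>
                   (\<exists>i<n. u t i \<noteq> 0 \<and> u t' i \<noteq> 0)} \<le> k"
  shows "\<exists>p C D. C \<in> carrier_mat n p \<and> D \<in> carrier_mat p m \<and> p \<le> card T \<and>
           k_sparse_factorization k E C D"
proof -
  \<comment> \<open>Terms that vanish on the index range contribute nothing to \<open>E\<close>;
    dropping them makes every column of \<open>C\<close> and every row of \<open>D\<close>
    nonzero.\<close>
  define T' where "T' = {t \<in> T. (\<exists>i<n. u t i \<noteq> 0) \<and> (\<exists>j<m. v t j \<noteq> 0)}"
  have T': "T' \<subseteq> T" "finite T'"
    using T by (auto simp: T'_def)
  obtain ys where ys: "set ys = T'" "distinct ys"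
    using finite_distinct_list[OF T'(2)] by blast
  define xs where "xs = sort_key ht ys"
  have xs: "set xs = T'" "distinct xs" "sorted (map ht xs)"
    using ys by (auto simp: xs_def)
  define p where "p = length xs"
  have xsT: "xs ! a \<in> T'" if "a < p" for a
    using that xs(1) by (auto simp: p_def)
  define C where "C = mat n p (\<lambda>(i, a). u (xs ! a) i)"
  define D where "D = mat p m (\<lambda>(a, j). v (xs ! a) j)"
  have CD: "C \<in> carrier_mat n p" "D \<in> carrier_mat p m"
    by (auto simp: C_def D_def)
  have bij: "bij_betw ((!) xs) {..<p} T'"
    using bij_betw_nth[OF xs(2)] xs(1) by (simp add: p_def)
  have "E = C * D"
  proof (rule eq_matI)
    show "dim_row E = dim_row (C * D)" "dim_col E = dim_col (C * D)"
      using E CD by auto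
    fix i j assume "i < dim_row (C * D)" "j < dim_col (C * D)"
    then have ij: "i < n" "j < m"
      using CD by auto
    have "(C * D) $$ (i, j) = (\<Sum>a<p. u (xs ! a) i * v (xs ! a) j)"
      using ij by (simp add: C_def D_def scalar_prod_def atLeast0LessThan)
    also have "\<dots> = (\<Sum>t\<in>T'. u t i * v t j)"
      by (rule sum.reindex_bij_betw[OF bij])
    also have "\<dots> = (\<Sum>t\<in>T. u t i * v t j)"
      using T ij by (intro sum.mono_neutral_left) (auto simp: T'_def)
    finally show "E $$ (i, j) = (C * D) $$ (i, j)"
      using entry[OF ij] by simp
  qed
  moreover have "col C a \<noteq> 0\<^sub>v n" if a: "a < p" for a
  proof -
    obtain i where "i < n" "u (xs ! a) i \<noteq> 0"
      using xsT[OF a] by (auto simp: T'_def)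
    then have "col C a $ i \<noteq> 0\<^sub>v n $ i"
      using a by (simp add: C_def)
    then show ?thesis
      by metis
  qed
  moreover have "row D a \<noteq> 0\<^sub>v m" if a: "a < p" for a
  proof -
    obtain j where "j < m" "v (xs ! a) j \<noteq> 0"
      using xsT[OF a] by (auto simp: T'_def)
    then have "row D a $ j \<noteq> 0\<^sub>v m $ j"
      using a by (simp add: D_def)
    then show ?thesis
      by metis
  qed
  moreover have "card (\<Union>a\<in>supp (col D j). forward_overlap C a) \<le> k" if j: "j < m" for j
  proof -
    let ?U = "\<Union>a\<in>supp (col D j). forward_overlap C a"
    let ?X = "{t' \<in> T. \<exists>t\<in>T. v t j \<noteq> 0 \<and> ht t \<le> ht t' \<and> (\<exists>i<n. u t i \<noteq> 0 \<and> u t' i \<noteq> 0)}"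
    have Up: "?U \<subseteq> {..<p}"
      using CD by (auto simp: forward_overlap_def)
    \<comment> \<open>Column numbers are sent back to the terms they stand for. This map is
      injective, so \<open>?U\<close> is no larger than the set bounded by hypothesis.\<close>
    have "(!) xs ` ?U \<subseteq> ?X"
    proof clarify
      fix a b assume a: "a \<in> supp (col D j)" and b: "b \<in> forward_overlap C a"
      have a': "a < p" "v (xs ! a) j \<noteq> 0"
        using a j by (auto simp: supp_def D_def)
      have b': "a \<le> b" "b < p"
        using b CD by (auto simp: forward_overlap_def)
      obtain i where i: "i < n" "u (xs ! a) i \<noteq> 0" "u (xs ! b) i \<noteq> 0"
        using b a' b' by (auto simp: forward_overlap_def supp_def C_def)
      have "ht (xs ! a) \<le> ht (xs ! b)"
        using sorted_nth_mono[OF xs(3), of a b] b' by (simp add: p_def)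
      then show "xs ! b \<in> T \<and> (\<exists>t\<in>T. v t j \<noteq> 0 \<and> ht t \<le> ht (xs ! b) \<and>
          (\<exists>i<n. u t i \<noteq> 0 \<and> u (xs ! b) i \<noteq> 0))"
        using xsT[OF a'(1)] xsT[OF b'(2)] T'(1) a'(2) i by blast
    qed
    moreover have "inj_on ((!) xs) ?U"
      using bij Up unfolding bij_betw_def by (meson inj_on_subset)
    ultimately have "card ?U \<le> card ?X"
      using T by (intro card_inj_on_le) auto
    then show ?thesis
      using bound[OF j] by simp
  qed
  ultimately have "k_sparse_factorization k E C D"
    using CD by (auto simp: k_sparse_factorization_def)
  moreover have "p \<le> card T"
    using card_mono[OF T T'(1)] distinct_card[OF xs(2)] xs(1) by (simp add: p_def)
  ultimately show ?thesis
    using CD by blast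
qed

section \<open>Counting elementary blocks\<close>

text \<open>The index \<open>i\<close> is the height of the children, one below that of
  \<open>N\<close>. The condition \<open>I \<noteq> J \<or> i = 0\<close> selects the blocks at
  which the recursive splitting stops.\<close>

definition node_blocks :: "(nat \<Rightarrow> nat set set) \<Rightarrow> nat \<Rightarrow> nat set \<Rightarrow> (nat set \<times> nat set) set" where
  "node_blocks P i N = {(I, J) \<in> children P (Suc i) N \<times> children P (Suc i) N. I \<noteq> J \<or> i = 0}"

text \<open>The height is kept in the triple because it later determines the order of the columns of
  \<open>C\<close>. Height \<open>h\<close> is absent: the only block generated there is diagonal,
  hence elementary only for \<open>h = 0\<close>.\<close>

definition blocks :: "nat \<Rightarrow> (nat \<Rightarrow> nat set set) \<Rightarrow> (nat \<times> nat set \<times> nat set) set" where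
  "blocks h P = (SIGMA i:{..<h}. \<Union>N\<in>P (Suc i). node_blocks P i N)"

lemma card_distinct_pairs:
  assumes "finite A"
  shows "card {(x, y) \<in> A \<times> A. x \<noteq> y} = card A * (card A - 1)"
proof -
  have "{(x, y) \<in> A \<times> A. x \<noteq> y} = (SIGMA x:A. A - {x})"
    by auto
  then show ?thesis
    using assms by simp
qed

section \<open>Nodes, children and degree of a dendrogram\<close>

locale dendro =
  fixes n h :: nat and P :: "nat \<Rightarrow> nat set set"
  assumes dendrogram: "dendrogram n h P"
begin

lemma partition: "i \<le> h \<Longrightarrow> partition_on {..<n} (P i)"
  and top: "P h = {{..<n}}"
  and bottom: "P 0 = (\<lambda>j. {j}) ` {..<n}"
  using dendrogram by (auto simp: dendrogram_def)

lemma finite_nodes: "i \<le> h \<Longrightarrow> finite (P i)"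
  using partition finite_elements by blast

lemma node_subset: "i \<le> h \<Longrightarrow> N \<in> P i \<Longrightarrow> N \<subseteq> {..<n}"
  using partition by (auto simp: partition_on_def)

lemma node_nonempty: "i \<le> h \<Longrightarrow> N \<in> P i \<Longrightarrow> N \<noteq> {}"
  using partition by (auto simp: partition_on_def)

lemma ex_node: "i \<le> h \<Longrightarrow> x < n \<Longrightarrow> \<exists>N\<in>P i. x \<in> N"
  using partition[of i] by (auto simp: partition_on_def)

lemma node_unique: "i \<le> h \<Longrightarrow> M \<in> P i \<Longrightarrow> N \<in> P i \<Longrightarrow> x \<in> M \<Longrightarrow> x \<in> N \<Longrightarrow> M = N"
  using partition[of i] unfolding partition_on_def disjoint_def by blast

lemma refines:
  assumes "i \<le> j" "j \<le> h"
  shows "refines {..<n} (P i) (P j)"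
  using assms
proof (induction j rule: dec_induct)
  case base
  then show ?case
    using partition refines_refl by auto
next
  case (step j)
  then show ?case
    using dendrogram refines_trans unfolding dendrogram_def by (metis Suc_leD Suc_le_lessD)
qed

lemma nested:
  assumes "i \<le> j" "j \<le> h" "M \<in> P i" "N \<in> P j" "x \<in> M" "x \<in> N"
  shows "M \<subseteq> N"
proof -
  obtain N' where "N' \<in> P j" "M \<subseteq> N'"
    using refines[OF assms(1,2)] assms(3) unfolding refines_def by blast
  then show ?thesis
    using node_unique[OF assms(2) _ assms(4)] assms(5,6) by blast
qed

lemma children_partition:
  assumes "i < h" "N \<in> P (Suc i)"
  shows "partition_on N (children P (Suc i) N)"
  using refines_obtains_subset[OF refines[of i "Suc i"]] assms by (simp add: children_def)

lemma finite_children: "i < h \<Longrightarrow> finite (children P (Suc i) N)"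
  by (rule finite_subset[OF _ finite_nodes[of i]]) (auto simp: children_def)

lemma card_children_pos:
  assumes "i < h" "N \<in> P (Suc i)"
  shows "0 < card (children P (Suc i) N)"
proof -
  have "children P (Suc i) N \<noteq> {}"
    using children_partition[OF assms] node_nonempty[of "Suc i" N] assms
    by (auto simp: partition_on_def)
  then show ?thesis
    using finite_children assms by (simp add: card_gt_0_iff)
qed

text \<open>Each node at height \<open>i\<close> is a child of exactly one node one level up:
  refinement provides a parent, and two parents would share the elements of a nonempty
  child.\<close>

lemma sum_card_children:
  assumes "i < h"
  shows "(\<Sum>N\<in>P (Suc i). card (children P (Suc i) N)) = card (P i)"
proof -
  have "P i = (\<Union>N\<in>P (Suc i). children P (Suc i) N)"
    using refines[of i "Suc i"] assms unfolding refines_def children_def by auto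
  moreover have "children P (Suc i) M \<inter> children P (Suc i) N = {}"
    if "M \<in> P (Suc i)" "N \<in> P (Suc i)" "M \<noteq> N" for M N
  proof (rule ccontr)
    assume "children P (Suc i) M \<inter> children P (Suc i) N \<noteq> {}"
    then obtain I where "I \<in> P i" "I \<subseteq> M" "I \<subseteq> N"
      by (auto simp: children_def)
    then show False
      using node_nonempty[of i I] node_unique[of "Suc i" M N] that assms by fastforce
  qed
  ultimately show ?thesis
    using assms finite_nodes[of "Suc i"] finite_children card_UN_disjoint[of "P (Suc i)" "children P (Suc i)"]
    by simp
qed

lemma card_children_le:
  assumes "i < h" "N \<in> P (Suc i)"
  shows "card (children P (Suc i) N) \<le> max_degree h P"
proof -
  have "{card (children P i N) | i N. i \<le> h \<and> N \<in> P i}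
      = (\<lambda>(i, N). card (children P i N)) ` (SIGMA i:{..h}. P i)"
    by auto
  then have "finite {card (children P i N) | i N. i \<le> h \<and> N \<in> P i}"
    using finite_nodes by (auto intro!: finite_imageI finite_SigmaI)
  then show ?thesis
    unfolding max_degree_def using assms by (intro Max_ge) (auto intro: Suc_leI)
qed

text \<open>If every node had at most one child, the number of nodes could not decrease on the way
  up, yet it falls from \<open>n\<close> leaves to a single root.\<close>

lemma max_degree_ge_2:
  assumes "n \<ge> 2"
  shows "max_degree h P \<ge> 2"
proof (rule ccontr)
  assume d: "\<not> 2 \<le> max_degree h P"
  have "card (P i) \<le> card (P (Suc i))" if "i < h" for i
  proof -
    have "card (children P (Suc i) N) \<le> 1" if "N \<in> P (Suc i)" for N
      using card_children_le[OF \<open>i < h\<close> that] d by linarith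
    then have "(\<Sum>N\<in>P (Suc i). card (children P (Suc i) N)) \<le> (\<Sum>N\<in>P (Suc i). 1)"
      by (intro sum_mono)
    then show ?thesis
      using sum_card_children[OF that] by simp
  qed
  then have "card (P 0) \<le> card (P j)" if "j \<le> h" for j
    using that by (induction j) (auto intro: le_trans)
  then have "card (P 0) \<le> card (P h)"
    by simp
  then show False
    using assms top bottom by (simp add: card_image)
qed

section \<open>Every matrix entry lies in exactly one elementary block\<close>

lemma generated_block_diagonal:
  assumes "i \<le> h" "N \<in> P i"
  shows "generated_block P h i N N"
  using assms
proof (induction i arbitrary: N rule: inc_induct)
  case base
  then show ?case
    by (simp add: generated_block.whole)
next
  case (step i)
  then obtain M where "M \<in> P (Suc i)" "N \<subseteq> M"
    using refines[of i "Suc i"] unfolding refines_def by auto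
  then show ?case
    using step generated_block.split[of P h i M N N] by (auto simp: children_def)
qed

lemma finite_node_blocks: "i < h \<Longrightarrow> finite (node_blocks P i N)"
  by (rule finite_subset[of _ "children P (Suc i) N \<times> children P (Suc i) N"])
    (auto simp: node_blocks_def finite_children)

lemma finite_blocks: "finite (blocks h P)"
  unfolding blocks_def
  by (intro finite_SigmaI finite_UN_I finite_nodes finite_node_blocks) auto

lemma blocksE:
  assumes "(i, I, J) \<in> blocks h P"
  obtains N where "i < h" "N \<in> P (Suc i)" "I \<in> P i" "J \<in> P i" "I \<subseteq> N" "J \<subseteq> N" "I \<noteq> J \<or> i = 0"
  using assms unfolding blocks_def node_blocks_def children_def by auto

text \<open>One further splitting of the diagonal block at the common parent produces the pair. In
  this way the rank hypothesis on \<open>E\<close> reaches all members of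
  \<open>blocks h P\<close>.\<close>

lemma blocks_elementary:
  assumes "(i, I, J) \<in> blocks h P"
  shows "elementary_block P h I J"
proof -
  obtain N where "i < h" "N \<in> P (Suc i)" "(I, J) \<in> node_blocks P i N"
    using assms unfolding blocks_def by auto
  then show ?thesis
    using generated_block.split[OF generated_block_diagonal[of "Suc i" N], of I J]
    unfolding node_blocks_def elementary_block_def by auto
qed

text \<open>Take the least \<open>i\<close> for which \<open>x\<close> and \<open>y\<close> share a
  node at height \<open>i + 1\<close>. Their nodes at height \<open>i\<close> are then different
  unless \<open>i = 0\<close>, so the splitting stops there.\<close>

lemma blocks_cover:
  assumes x: "x < n" and y: "y < n" and h: "h > 0"
  shows "\<exists>i I J. (i, I, J) \<in> blocks h P \<and> x \<in> I \<and> y \<in> J"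
proof -
  define Q where "Q i \<longleftrightarrow> (\<exists>N\<in>P (Suc i). x \<in> N \<and> y \<in> N)" for i
  define i where "i = (LEAST i. Q i)"
  have "Q (h - 1)"
    using h top x y by (simp add: Q_def)
  then have Qi: "Q i" and ih: "i < h"
    unfolding i_def using LeastI[of Q] Least_le[of Q "h - 1"] h by (blast, linarith)
  obtain N where N: "N \<in> P (Suc i)" "x \<in> N" "y \<in> N"
    using Qi Q_def by blast
  obtain I J where IJ: "I \<in> P i" "x \<in> I" "J \<in> P i" "y \<in> J"
    using ex_node x y ih by (meson less_imp_le)
  have "I \<noteq> J" if i0: "i \<noteq> 0"
  proof
    assume "I = J"
    then have "Q (i - 1)"
      using IJ i0 by (auto simp: Q_def)
    then show False
      using i0 Least_le[of Q "i - 1"] by (simp add: i_def[symmetric])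
  qed
  moreover have "I \<subseteq> N" "J \<subseteq> N"
    using nested[of i "Suc i"] ih IJ N by auto
  ultimately have "(i, I, J) \<in> blocks h P"
    using ih N IJ by (auto simp: blocks_def node_blocks_def children_def)
  then show ?thesis
    using IJ by blast
qed

text \<open>If \<open>i < i'\<close>, the common parent of \<open>I\<close> and \<open>J\<close>
  meets \<open>I'\<close> in \<open>x\<close> and has height at most \<open>i'\<close>, so it lies
  inside \<open>I'\<close>. Then \<open>y\<close> belongs to both \<open>I'\<close> and
  \<open>J'\<close>, which forces a diagonal block at positive height, a contradiction. At equal
  heights, disjointness of the nodes suffices.\<close>

lemma blocks_unique:
  assumes b: "(i, I, J) \<in> blocks h P" and b': "(i', I', J') \<in> blocks h P"
    and x: "x \<in> I" "x \<in> I'" and y: "y \<in> J" "y \<in> J'"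
  shows "(i, I, J) = (i', I', J')"
proof -
  have le: "\<not> i < i'"
    if b: "(i, I, J) \<in> blocks h P" and b': "(i', I', J') \<in> blocks h P"
      and x: "x \<in> I" "x \<in> I'" and y: "y \<in> J" "y \<in> J'" for i i' I I' J J'
  proof
    assume less: "i < i'"
    obtain N where N: "N \<in> P (Suc i)" "I \<subseteq> N" "J \<subseteq> N"
      using b by (rule blocksE)
    have b'': "i' < h" "I' \<in> P i'" "J' \<in> P i'" "I' \<noteq> J' \<or> i' = 0"
      using b' by (auto elim: blocksE)
    have "N \<subseteq> I'"
      using nested[of "Suc i" i' N I' x] less b'' N x by auto
    then show False
      using node_unique[of i' I' J' y] b'' y N less by auto
  qed
  have eq: "i = i'"
    using le[OF b b' x y] le[OF b' b x(2,1) y(2,1)] by simp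
  have "i \<le> h" "I \<in> P i" "J \<in> P i" "I' \<in> P i" "J' \<in> P i"
    using b b' eq by (auto elim: blocksE)
  then show ?thesis
    using eq node_unique[of i I I' x] node_unique[of i J J' y] x y by simp
qed

section \<open>Bounds on the number of blocks\<close>

lemma card_node_blocks_le:
  assumes i: "i < h" and N: "N \<in> P (Suc i)"
  shows "card (node_blocks P i N)
    \<le> max_degree h P * (max_degree h P - 1) + (if i = 0 then max_degree h P else 0)"
proof -
  let ?c = "card (children P (Suc i) N)" and ?d = "max_degree h P"
  have c: "?c \<le> ?d"
    using card_children_le[OF assms] .
  have fin: "finite (children P (Suc i) N)"
    using finite_children[OF i] .
  show ?thesis
  proof (cases "i = 0")
    case True
    have "node_blocks P i N = children P (Suc i) N \<times> children P (Suc i) N"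
      using True by (auto simp: node_blocks_def)
    then have "card (node_blocks P i N) = ?c * ?c"
      by (simp add: card_cartesian_product)
    also have "\<dots> \<le> ?d * ?d"
      using c by (intro mult_le_mono)
    \<comment> \<open>At height 0 the diagonal pairs count as well; they account for the extra
      \<open>?d\<close>.\<close>
    also have "\<dots> \<le> ?d * (?d - 1) + ?d"
      by (cases ?d) auto
    finally show ?thesis
      using True by simp
  next
    case False
    have "card (node_blocks P i N) = ?c * (?c - 1)"
      using False card_distinct_pairs[OF fin] by (simp add: node_blocks_def)
    also have "\<dots> \<le> ?d * (?d - 1)"
      using c by (intro mult_le_mono diff_le_mono)
    finally show ?thesis
      using False by simp
  qed
qed

text \<open>The term \<open>max_degree h P * card (P j)\<close> is a potential that makes the sum
  telescope without subtraction: it starts at \<open>max_degree h P * n\<close>, and its decrease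
  from one level to the next pays for the off-diagonal blocks of that level.\<close>

lemma card_off_diagonal_le:
  assumes j: "j \<le> h"
  shows "(\<Sum>i<j. \<Sum>N\<in>P (Suc i). card (children P (Suc i) N) * (card (children P (Suc i) N) - 1))
      + max_degree h P * card (P j) \<le> max_degree h P * n"
  using j
proof (induction j)
  case 0
  then show ?case
    using bottom by (simp add: card_image)
next
  case (Suc j)
  let ?c = "\<lambda>N. card (children P (Suc j) N)" and ?d = "max_degree h P"
  have "(\<Sum>N\<in>P (Suc j). ?c N * (?c N - 1)) + ?d * card (P (Suc j))
      = (\<Sum>N\<in>P (Suc j). ?c N * (?c N - 1) + ?d)"
    by (simp add: sum.distrib)
  also have "\<dots> \<le> (\<Sum>N\<in>P (Suc j). ?d * ?c N)"
  proof (rule sum_mono)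
    fix N assume N: "N \<in> P (Suc j)"
    obtain c where c: "?c N = Suc c"
      using card_children_pos[OF _ N] Suc.prems gr0_implies_Suc by (metis Suc_le_lessD)
    have "Suc c \<le> ?d"
      using card_children_le[OF _ N] Suc.prems c by simp
    \<comment> \<open>With \<open>c + 1\<close> children the claim is
      \<open>(c + 1) * c + ?d \<le> ?d * (c + 1)\<close>, which follows from
      \<open>c + 1 \<le> ?d\<close>.\<close>
    then show "?c N * (?c N - 1) + ?d \<le> ?d * ?c N"
      using c mult_le_mono1[of "Suc c" ?d c] by simp
  qed
  also have "\<dots> = ?d * card (P j)"
    using sum_card_children[of j] Suc.prems by (simp add: sum_distrib_left[symmetric])
  finally show ?case
    using Suc by simp
qed

lemma card_blocks_le: "card (blocks h P) \<le> max_degree h P * n + n"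
proof -
  let ?O = "\<lambda>i N. {(I, J) \<in> children P (Suc i) N \<times> children P (Suc i) N. I \<noteq> J}"
  let ?off = "SIGMA i:{..<h}. \<Union>N\<in>P (Suc i). ?O i N"
  let ?diag = "(\<lambda>x. (0 :: nat, {x}, {x})) ` {..<n}"
  have finO: "finite (?O i N)" if "i < h" for i N
    using finite_node_blocks[OF that, of N]
    by (rule finite_subset[rotated]) (auto simp: node_blocks_def)
  have finU: "finite (\<Union>N\<in>P (Suc i). ?O i N)" if "i < h" for i
    using that finite_nodes[of "Suc i"] finO by (intro finite_UN_I) auto
  \<comment> \<open>A diagonal block occurs only at height 0, where the nodes are singletons; there
    are at most \<open>n\<close> of these.\<close>
  have "blocks h P \<subseteq> ?off \<union> ?diag"
    using bottom by (fastforce simp: blocks_def node_blocks_def children_def)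
  moreover have "finite ?off"
    using finU by (intro finite_SigmaI) auto
  ultimately have "card (blocks h P) \<le> card (?off \<union> ?diag)"
    by (intro card_mono) auto
  also have "\<dots> \<le> card ?off + card ?diag"
    by (rule card_Un_le)
  also have "card ?diag \<le> n"
    using card_image_le[of "{..<n}"] by simp
  also have "card ?off = (\<Sum>i<h. card (\<Union>N\<in>P (Suc i). ?O i N))"
    using finU by (intro card_SigmaI) auto
  also have "\<dots> \<le> (\<Sum>i<h. \<Sum>N\<in>P (Suc i). card (?O i N))"
    using finite_nodes by (intro sum_mono card_UN_le) auto
  also have "\<dots> = (\<Sum>i<h. \<Sum>N\<in>P (Suc i).
      card (children P (Suc i) N) * (card (children P (Suc i) N) - 1))"
    using finite_children by (intro sum.cong refl card_distinct_pairs) auto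
  also have "\<dots> \<le> max_degree h P * n"
    using card_off_diagonal_le[of h] by simp
  finally show ?thesis
    by simp
qed

text \<open>If a column of \<open>E\<close> passes through a block and \<open>I'\<close> overlaps the rows of that block at
  the same or a larger height, then the node containing \<open>I'\<close> also contains that column.\<close>

lemma card_blocks_above_le:
  assumes y: "y < n"
  shows "card {(i', I', J') \<in> blocks h P. \<exists>(i, I, J) \<in> blocks h P.
      y \<in> J \<and> i \<le> i' \<and> I \<inter> I' \<noteq> {}}
    \<le> max_degree h P * (max_degree h P - 1) * h + max_degree h P" (is "card ?X \<le> _")
proof -
  let ?d = "max_degree h P"
  have "\<forall>i<h. \<exists>N. N \<in> P (Suc i) \<and> y \<in> N"
    using ex_node[OF _ y] by (meson Suc_leI)
  then obtain N where N: "\<And>i. i < h \<Longrightarrow> N i \<in> P (Suc i) \<and> y \<in> N i"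
    by metis
  have "?X \<subseteq> (SIGMA i:{..<h}. node_blocks P i (N i))"
  proof
    fix t
    assume "t \<in> ?X"
    then obtain i' I' J' i I J z where t: "t = (i', I', J')"
      and b: "(i, I, J) \<in> blocks h P" and b': "(i', I', J') \<in> blocks h P"
      and yJ: "y \<in> J" and le: "i \<le> i'" and z: "z \<in> I" "z \<in> I'"
      by clarsimp blast
    obtain M where M: "M \<in> P (Suc i)" "I \<subseteq> M" "J \<subseteq> M"
      using b by (rule blocksE)
    obtain M' where M': "i' < h" "M' \<in> P (Suc i')" "(I', J') \<in> node_blocks P i' M'"
      using b' unfolding blocks_def by auto
    then have I'M': "I' \<subseteq> M'"
      by (auto simp: node_blocks_def children_def)
    \<comment> \<open>The shared row \<open>z\<close> lies in both nodes, so the lower one is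
      contained in the higher one. Hence \<open>y\<close> is in \<open>M'\<close>, which leaves a
      single node per height.\<close>
    have "M \<subseteq> M'"
      using nested[of "Suc i" "Suc i'" M M' z] le M M' I'M' z by auto
    then have "M' = N i'"
      using node_unique[of "Suc i'" M' "N i'" y] M' N M yJ by auto
    then show "t \<in> (SIGMA i:{..<h}. node_blocks P i (N i))"
      using M' t by simp
  qed
  then have "card ?X \<le> card (SIGMA i:{..<h}. node_blocks P i (N i))"
    using finite_node_blocks by (intro card_mono finite_SigmaI) auto
  also have "\<dots> = (\<Sum>i<h. card (node_blocks P i (N i)))"
    using finite_node_blocks by (intro card_SigmaI) auto
  also have "\<dots> \<le> (\<Sum>i<h. ?d * (?d - 1) + (if i = 0 then ?d else 0))"
    using card_node_blocks_le N by (intro sum_mono) auto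
  also have "\<dots> \<le> ?d * (?d - 1) * h + ?d"
    by (simp add: sum.distrib mult.commute)
  finally show ?thesis .
qed

end

theorem theorem4p4:
  fixes n h r d :: nat
    and P :: "nat \<Rightarrow> nat set set"
    and E :: "real mat"
  assumes "n \<ge> 2"
    and "dendrogram n h P"
    and "d = max_degree h P"
    and "H_matrix n P h r E"
  shows "\<exists>p C D. C \<in> carrier_mat n p \<and> D \<in> carrier_mat p n \<and>
           p \<le> r * d\<^sup>2 * n \<and>
           k_sparse_factorization (r * d * (d - 1) * (h + 1)) E C D"
proof -
  interpret dendro n h P
    using assms(2) by unfold_locales
  have d2: "d \<ge> 2"
    using max_degree_ge_2 assms by simp
  \<comment> \<open>At height 0 the root partition would be the partition into
    \<open>n \<ge> 2\<close> singletons.\<close>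
  have h: "h > 0"
  proof (rule ccontr)
    assume "\<not> h > 0"
    then have "(\<lambda>j. {j}) ` {..<n} = {{..<n}}"
      using top bottom by simp
    then have "card ((\<lambda>j. {j}) ` {..<n}) = 1"
      by simp
    then show False
      using assms(1) by (simp add: card_image)
  qed
  let ?B = "blocks h P"
  have E: "E \<in> carrier_mat n n"
    using assms(4) by (simp add: H_matrix_def)
  define factors where "factors b u v \<longleftrightarrow>
      (\<forall>i\<in>fst (snd b). \<forall>j\<in>snd (snd b). E $$ (i, j) = (\<Sum>s<r. u s i * v s j)) \<and>
      (\<forall>s. \<forall>i. i \<notin> fst (snd b) \<longrightarrow> u s i = 0) \<and> (\<forall>s. \<forall>j. j \<notin> snd (snd b) \<longrightarrow> v s j = 0)"
    for b :: "nat \<times> nat set \<times> nat set" and u v :: "nat \<Rightarrow> nat \<Rightarrow> real"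
  have "\<exists>u v. factors (a, I, J) u v" if b: "(a, I, J) \<in> ?B" for a I J
  proof -
    have "a < h" "I \<in> P a" "J \<in> P a"
      using b by (auto elim: blocksE)
    then have "I \<subseteq> {..<n}" "J \<subseteq> {..<n}"
      using node_subset[of a] by auto
    moreover have "vec_space.rank (card I) (submatrix E I J) \<le> r"
      using assms(4) blocks_elementary[OF b] by (simp add: H_matrix_def)
    ultimately show ?thesis
      using submatrix_rank_le_imp_sum_rank_one[OF E] by (simp add: factors_def)
  qed
  then have "\<forall>b\<in>?B. \<exists>u v. factors b u v"
    by auto
  then obtain u v where factors: "\<And>b. b \<in> ?B \<Longrightarrow> factors b (u b) (v b)"
    by metis
  have uv: "E $$ (i, j) = (\<Sum>s<r. u (a, I, J) s i * v (a, I, J) s j)"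
    if "(a, I, J) \<in> ?B" "i \<in> I" "j \<in> J" for a I J i j
    using factors that by (auto simp: factors_def)
  have u0: "i \<in> I" if "(a, I, J) \<in> ?B" "u (a, I, J) s i \<noteq> 0" for a I J s i
    using factors[OF that(1)] that(2) by (auto simp: factors_def)
  have v0: "j \<in> J" if "(a, I, J) \<in> ?B" "v (a, I, J) s j \<noteq> 0" for a I J s j
    using factors[OF that(1)] that(2) by (auto simp: factors_def)
  let ?T = "?B \<times> {..<r}"
  have fin: "finite ?T"
    using finite_blocks by simp
  have entry: "E $$ (i, j) = (\<Sum>t\<in>?T. u (fst t) (snd t) i * v (fst t) (snd t) j)"
    if i: "i < n" and j: "j < n" for i j
  proof -
    obtain a I J where b: "(a, I, J) \<in> ?B" "i \<in> I" "j \<in> J"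
      using blocks_cover[OF i j h] by blast
    \<comment> \<open>Two nonzero factors would put the entry \<open>(i, j)\<close> into a second
      block.\<close>
    have zero: "u b' s i * v b' s j = 0" if "b' \<in> ?B - {(a, I, J)}" for b' s
    proof (cases b')
      case (fields a' I' J')
      then show ?thesis
        using that blocks_unique[OF b(1) _ b(2) _ b(3), of a' I' J'] u0[of a' I' J' s i]
          v0[of a' I' J' s j] by auto
    qed
    have "(\<Sum>t\<in>?T. u (fst t) (snd t) i * v (fst t) (snd t) j)
        = (\<Sum>b'\<in>?B. \<Sum>s<r. u b' s i * v b' s j)"
      by (simp add: sum.cartesian_product case_prod_unfold)
    also have "\<dots> = (\<Sum>b'\<in>{(a, I, J)}. \<Sum>s<r. u b' s i * v b' s j)"
      using finite_blocks b zero by (intro sum.mono_neutral_right) auto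
    finally show ?thesis
      using uv[OF b] by simp
  qed
  have bound: "card {t' \<in> ?T. \<exists>t\<in>?T. v (fst t) (snd t) j \<noteq> 0 \<and> fst (fst t) \<le> fst (fst t') \<and>
      (\<exists>i<n. u (fst t) (snd t) i \<noteq> 0 \<and> u (fst t') (snd t') i \<noteq> 0)}
      \<le> r * d * (d - 1) * (h + 1)" (is "card ?Y \<le> _") if j: "j < n" for j
  proof -
    let ?X = "{(i', I', J') \<in> ?B. \<exists>(i, I, J) \<in> ?B. j \<in> J \<and> i \<le> i' \<and> I \<inter> I' \<noteq> {}}"
    have "?Y \<subseteq> ?X \<times> {..<r}"
    proof
      fix t' assume "t' \<in> ?Y"
      then obtain a' I' J' s' a I J s i where t': "t' = ((a', I', J'), s')" "(a', I', J') \<in> ?B" "s' < r"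
        and b: "(a, I, J) \<in> ?B" and le: "a \<le> a'" and nz: "v (a, I, J) s j \<noteq> 0"
          "u (a, I, J) s i \<noteq> 0" "u (a', I', J') s' i \<noteq> 0"
        by auto
      have "j \<in> J" "i \<in> I \<inter> I'"
        using u0[OF b nz(2)] u0[OF t'(2) nz(3)] v0[OF b nz(1)] by auto
      then show "t' \<in> ?X \<times> {..<r}"
        using t' b le by blast
    qed
    moreover have "finite ?X"
      by (rule finite_subset[OF _ finite_blocks]) auto
    ultimately have "card ?Y \<le> card (?X \<times> {..<r})"
      by (intro card_mono) auto
    also have "\<dots> \<le> (d * (d - 1) * h + d) * r"
      using card_blocks_above_le[OF j] assms(3) by (simp add: card_cartesian_product)
    \<comment> \<open>Since \<open>d \<ge> 2\<close>, the diagonal surplus \<open>d\<close> is at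
      most \<open>d * (d - 1)\<close>, the share of one more height. This is the origin of the
      factor \<open>h + 1\<close>.\<close>
    also have "\<dots> \<le> (d * (d - 1) * h + d * (d - 1)) * r"
      using d2 by (intro mult_le_mono add_le_mono) auto
    also have "\<dots> = r * d * (d - 1) * (h + 1)"
      by (simp add: algebra_simps)
    finally show ?thesis .
  qed
  obtain p C D where CD: "C \<in> carrier_mat n p" "D \<in> carrier_mat p n" "p \<le> card ?T"
    "k_sparse_factorization (r * d * (d - 1) * (h + 1)) E C D"
    using k_sparse_factorization_of_rank_one_terms[OF fin E entry bound] by blast
  have "card ?T \<le> (d * n + n) * r"
    using card_blocks_le assms(3) by (simp add: card_cartesian_product)
  also have "\<dots> \<le> (d\<^sup>2 * n) * r"
  proof (rule mult_le_mono1)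
    \<comment> \<open>From \<open>d \<ge> 2\<close> one gets
      \<open>d * d \<ge> 2 * d \<ge> d + 1\<close>; this absorbs the \<open>n\<close> diagonal
      blocks into the bound.\<close>
    have "d + 1 \<le> d\<^sup>2"
      unfolding power2_eq_square using d2 mult_le_mono1[OF d2, of d] by linarith
    then show "d * n + n \<le> d\<^sup>2 * n"
      using mult_le_mono1[of "d + 1" "d\<^sup>2" n] by simp
  qed
  finally have "p \<le> r * d\<^sup>2 * n"
    using CD(3) by (simp add: mult.commute mult.left_commute)
  then show ?thesis
    using CD by blast
qed

end
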